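(* Let $n\geq 2$ be an integer. Then for every integer $k > (n-1)^2+3$, $$a_n(k) = 2a_n(k-1)-2a_n(k-3)+a_n(k-4).$$
   Context: For integers $n\geq 1$ and $k\geq 0$, the $n$ by $k$ grid is the set of points $\{1,\dots,n\}\times\{1,\dots,k\}\subset\mathbb{R}^2$ (empty if $k=0$). $a_n(k)$ denotes the number of isosceles triangles of nonzero area formed by 3 distinct points of the $n$ by $k$ grid, i.e. the number of 3-element subsets of the grid that are non-collinear and are the vertices of a triangle having at least two sides of equal Euclidean length. *)

theory Defs
  imports "HOL-Analysis.Analysis"
begin

text \<open>
  The plane is \<^typ>\<open>real \<times> real\<close>, on which \<^const>\<open>dist\<close> is the Euclidean distance.
\<close>

definition grid :: "nat \<Rightarrow> nat \<Rightarrow> (real \<times> real) set" where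
  "grid n k = {(real i, real j) | i j. i \<in> {1..n} \<and> j \<in> {1..k}}"

text \<open>
  A triangle is identified with its set of vertices. As the set has three elements,
  \<open>A\<close>, \<open>B\<close>, \<open>C\<close> are distinct; \<open>A\<close> is an apex. Nonzero area is non-collinearity.
\<close>

definition isosceles_triangle :: "(real \<times> real) set \<Rightarrow> bool" where
  "isosceles_triangle T \<longleftrightarrow>
     card T = 3 \<and> \<not> collinear T \<and> (\<exists>A B C. T = {A, B, C} \<and> dist A B = dist A C)"

definition num_isosceles :: "nat \<Rightarrow> nat \<Rightarrow> nat" where
  "num_isosceles n k = card {T. T \<subseteq> grid n k \<and> isosceles_triangle T}"

end

theory Submission
  imports Defs
begin

text \<open>
  The recurrence says that the second difference
  \<open>a(k) - 2 a(k - 1) + a(k - 2)\<close> has the same value at \<open>k\<close> and at \<open>k - 2\<close>.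
  By inclusion and exclusion over the triangles that avoid the first row and those that
  avoid the last row, this second difference counts the isosceles triangles that touch both
  the first and the last row (\<open>second_difference_num_isosceles\<close>).

  Such a triangle is very long compared with the width of the grid. If its legs had different
  vertical extents \<open>u \<noteq> v\<close>, then \<open>\<bar>u\<^sup>2 - v\<^sup>2\<bar> \<ge> u + v \<ge> k - 1 > (n - 1)\<^sup>2\<close>, which the horizontal
  extents, each at most \<open>n - 1\<close>, cannot compensate. So the legs agree in each
  coordinate separately (\<open>long_legs_agree_coordinatewise\<close>). That property, unlike being
  isosceles, survives an affine stretching of the rows. Moreover every vertex then lies in
  the first, the last or the exact middle row, so a stretching from \<open>k\<close> to \<open>k'\<close> rows sends
  vertices to grid points as long as \<open>k\<close> and \<open>k'\<close> have the same parity. Stretching in the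
  two directions shows that there are equally many such triangles for \<open>k\<close> and for \<open>k'\<close>
  (\<open>card_spanning_isosceles_parity\<close>).
\<close>

section \<open>Grids\<close>

lemma mem_grid_iff:
  "p \<in> grid n k \<longleftrightarrow> (\<exists>i j. p = (real i, real j) \<and> 1 \<le> i \<and> i \<le> n \<and> 1 \<le> j \<and> j \<le> k)"
  by (auto simp: grid_def)

lemma finite_grid: "finite (grid n k)"
proof -
  have "grid n k \<subseteq> (\<lambda>(i, j). (real i, real j)) ` ({1..n} \<times> {1..k})"
    by (auto simp: grid_def)
  then show ?thesis
    by (rule finite_subset) simp
qed

lemma grid_Suc_minus_last_row:
  "{p \<in> grid n (Suc k). snd p \<noteq> real (Suc k)} = grid n k"
  by (auto simp: mem_grid_iff le_Suc_eq)

section \<open>Affine maps of the rows\<close>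

definition stretch_rows :: "real \<Rightarrow> real \<Rightarrow> real \<times> real \<Rightarrow> real \<times> real" where
  "stretch_rows c d p = (fst p, c * snd p + d)"

lemma fst_stretch_rows [simp]: "fst (stretch_rows c d p) = fst p"
  and snd_stretch_rows [simp]: "snd (stretch_rows c d p) = c * snd p + d"
  by (simp_all add: stretch_rows_def)

lemma inj_stretch_rows: "c \<noteq> 0 \<Longrightarrow> inj (stretch_rows c d)"
  by (rule injI) (simp add: stretch_rows_def prod_eq_iff)

lemma collinear_stretch_rowsD:
  assumes "c \<noteq> 0" and "collinear (stretch_rows c d ` T)"
  shows "collinear T"
proof -
  obtain u where u: "\<And>x y. x \<in> T \<Longrightarrow> y \<in> T \<Longrightarrow>
      \<exists>t. stretch_rows c d x - stretch_rows c d y = t *\<^sub>R u"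
    using assms(2) unfolding collinear_def by blast
  have "\<exists>t. x - y = t *\<^sub>R (fst u, snd u / c)" if xy: "x \<in> T" "y \<in> T" for x y
  proof -
    obtain t where "stretch_rows c d x - stretch_rows c d y = t *\<^sub>R u"
      using u[OF xy] by blast
    then have "x - y = t *\<^sub>R (fst u, snd u / c)"
      using assms(1) by (auto simp: prod_eq_iff field_simps)
    then show ?thesis by blast
  qed
  then show ?thesis unfolding collinear_def by blast
qed

lemma dist_eq_iff_sum_squares:
  fixes A B C :: "real \<times> real"
  shows "dist A B = dist A C \<longleftrightarrow>
    (fst B - fst A)\<^sup>2 + (snd B - snd A)\<^sup>2 = (fst C - fst A)\<^sup>2 + (snd C - snd A)\<^sup>2"
  by (simp add: dist_prod_def dist_real_def power2_commute)

lemma isosceles_triangle_stretch_rowsI: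
  assumes "c \<noteq> 0" and "isosceles_triangle {A, B, C}"
    and "dist (stretch_rows c d A) (stretch_rows c d B)
       = dist (stretch_rows c d A) (stretch_rows c d C)"
  shows "isosceles_triangle (stretch_rows c d ` {A, B, C})"
proof -
  have "card (stretch_rows c d ` {A, B, C}) = 3"
    using assms(2) card_image[OF inj_on_subset[OF inj_stretch_rows[OF assms(1)] subset_UNIV]]
    unfolding isosceles_triangle_def by (simp del: image_insert)
  moreover have "\<not> collinear (stretch_rows c d ` {A, B, C})"
    using assms(2) collinear_stretch_rowsD[OF assms(1)]
    unfolding isosceles_triangle_def by blast
  moreover have "stretch_rows c d ` {A, B, C}
      = {stretch_rows c d A, stretch_rows c d B, stretch_rows c d C}"
    by simp
  ultimately show ?thesis
    using assms(3) unfolding isosceles_triangle_def by blast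
qed

lemma isosceles_triangle_shift_rows:
  assumes "isosceles_triangle T"
  shows "isosceles_triangle (stretch_rows 1 d ` T)"
proof -
  obtain A B C where T: "T = {A, B, C}" and eq: "dist A B = dist A C"
    using assms unfolding isosceles_triangle_def by blast
  have "dist (stretch_rows 1 d A) (stretch_rows 1 d B)
      = dist (stretch_rows 1 d A) (stretch_rows 1 d C)"
    using eq by (simp add: dist_eq_iff_sum_squares)
  then show ?thesis
    using assms isosceles_triangle_stretch_rowsI[of 1] unfolding T by simp
qed

lemma stretch_rows_inverse: "stretch_rows 1 (- d) (stretch_rows 1 d p) = p"
  by (simp add: stretch_rows_def)

lemma shift_grid:
  "stretch_rows 1 1 ` grid n k = {p \<in> grid n (Suc k). snd p \<noteq> 1}"
proof (intro equalityI subsetI)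
  fix p assume "p \<in> stretch_rows 1 1 ` grid n k"
  then obtain i j where p: "p = (real i, real (Suc j))"
      and "1 \<le> i" "i \<le> n" "1 \<le> j" "j \<le> k"
    by (auto simp: mem_grid_iff stretch_rows_def add.commute)
  then show "p \<in> {p \<in> grid n (Suc k). snd p \<noteq> 1}"
    unfolding p mem_Collect_eq mem_grid_iff
    by (intro conjI exI[of _ i] exI[of _ "Suc j"]) auto
next
  fix p assume "p \<in> {p \<in> grid n (Suc k). snd p \<noteq> 1}"
  then obtain i j where p: "p = (real i, real j)"
      and ij: "1 \<le> i" "i \<le> n" "1 \<le> j" "j \<le> Suc k" "j \<noteq> 1"
    by (auto simp: mem_grid_iff)
  then have "p = stretch_rows 1 1 (real i, real (j - 1))"
    by (simp add: stretch_rows_def of_nat_diff)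
  moreover have "(real i, real (j - 1)) \<in> grid n k"
    unfolding mem_grid_iff using ij by (intro exI[of _ i] exI[of _ "j - 1"]) auto
  ultimately show "p \<in> stretch_rows 1 1 ` grid n k" by blast
qed

lemma num_isosceles_shifted_grid:
  "card {T. T \<subseteq> stretch_rows 1 1 ` grid n k \<and> isosceles_triangle T} = num_isosceles n k"
proof -
  let ?f = "image (stretch_rows 1 1)"
  have "{T. T \<subseteq> stretch_rows 1 1 ` grid n k \<and> isosceles_triangle T}
      = ?f ` {T. T \<subseteq> grid n k \<and> isosceles_triangle T}"
  proof (intro equalityI subsetI)
    fix T assume T: "T \<in> {T. T \<subseteq> stretch_rows 1 1 ` grid n k \<and> isosceles_triangle T}"
    then obtain S where S: "S \<subseteq> grid n k" "T = ?f S"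
      by (auto simp: subset_image_iff)
    have "stretch_rows 1 (- 1) ` T = S"
      unfolding S(2) image_image by (simp add: stretch_rows_inverse)
    then have "isosceles_triangle S"
      using T isosceles_triangle_shift_rows[of T "- 1"] by simp
    with S show "T \<in> ?f ` {T. T \<subseteq> grid n k \<and> isosceles_triangle T}" by blast
  qed (use isosceles_triangle_shift_rows in blast)
  moreover have "inj_on ?f {T. T \<subseteq> grid n k \<and> isosceles_triangle T}"
    by (rule inj_onI) (simp add: inj_stretch_rows inj_image_eq_iff)
  ultimately show ?thesis
    unfolding num_isosceles_def by (simp add: card_image)
qed

section \<open>The second difference counts spanning triangles\<close>

definition spanning_isosceles :: "nat \<Rightarrow> nat \<Rightarrow> (real \<times> real) set set" where
  "spanning_isosceles n k =
     {T. T \<subseteq> grid n k \<and> isosceles_triangle T \<and> 1 \<in> snd ` T \<and> real k \<in> snd ` T}"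

lemma finite_spanning_isosceles: "finite (spanning_isosceles n k)"
  by (rule finite_subset[of _ "Pow (grid n k)"])
     (auto simp: spanning_isosceles_def finite_grid)

text \<open>
  The triangles that miss the last row, those that miss the first row, and those that miss both
  all live in a possibly shifted smaller grid.
\<close>

lemma second_difference_num_isosceles:
  "num_isosceles n (Suc (Suc m)) + num_isosceles n m
     = 2 * num_isosceles n (Suc m) + card (spanning_isosceles n (Suc (Suc m)))"
proof -
  let ?X = "\<lambda>G. {T. T \<subseteq> G \<and> isosceles_triangle T}"
  let ?G = "grid n (Suc (Suc m))"
  let ?low = "grid n (Suc m)"
  let ?high = "stretch_rows 1 1 ` grid n (Suc m)"
  let ?mid = "stretch_rows 1 1 ` grid n m"
  have low: "?low = {p \<in> ?G. snd p \<noteq> real (Suc (Suc m))}"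
    by (simp only: grid_Suc_minus_last_row)
  have high: "?high = {p \<in> ?G. snd p \<noteq> 1}"
    by (rule shift_grid)
  have mid: "?mid = ?low \<inter> ?high"
    unfolding high shift_grid unfolding low by auto
  have fin: "finite (?X H)" if "H \<subseteq> ?G" for H
    by (rule finite_subset[of _ "Pow ?G"]) (use that in \<open>auto simp: finite_grid\<close>)
  have sub: "?low \<subseteq> ?G" "?high \<subseteq> ?G"
    unfolding high unfolding low by auto
  have avoid: "T \<subseteq> {p \<in> ?G. snd p \<noteq> y} \<longleftrightarrow> T \<subseteq> ?G \<and> y \<notin> snd ` T" for T y
    by (auto simp del: split_paired_All)
  have split: "?X ?G = (?X ?low \<union> ?X ?high) \<union> spanning_isosceles n (Suc (Suc m))"
    unfolding high unfolding low avoid spanning_isosceles_def by blast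
  have disj: "(?X ?low \<union> ?X ?high) \<inter> spanning_isosceles n (Suc (Suc m)) = {}"
    unfolding high unfolding low avoid spanning_isosceles_def by blast
  have "card (?X ?G) = card (?X ?low \<union> ?X ?high) + card (spanning_isosceles n (Suc (Suc m)))"
    unfolding split
    by (rule card_Un_disjoint) (use fin sub disj finite_spanning_isosceles in auto)
  moreover have "card (?X ?low) + card (?X ?high)
      = card (?X ?low \<union> ?X ?high) + card (?X ?mid)"
  proof -
    have "?X ?mid = ?X ?low \<inter> ?X ?high"
      unfolding mid by auto
    then show ?thesis
      using card_Un_Int[OF fin[OF sub(1)] fin[OF sub(2)]] by simp
  qed
  ultimately show ?thesis
    unfolding num_isosceles_shifted_grid unfolding num_isosceles_def[symmetric] by linarith
qed

section \<open>Long isosceles triangles\<close>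

text \<open>
  The vertical extents \<open>u\<close> and \<open>v\<close> of the two legs add up to at least the vertical extent of
  the whole triangle, and distinct integers satisfy \<open>\<bar>u\<^sup>2 - v\<^sup>2\<bar> \<ge> \<bar>u\<bar> + \<bar>v\<bar>\<close>.
\<close>

lemma long_legs_agree_coordinatewise:
  assumes grid: "A \<in> grid n k" "B \<in> grid n k" "C \<in> grid n k"
    and apex: "dist A B = dist A C"
    and span: "1 \<in> snd ` {A, B, C}" "real k \<in> snd ` {A, B, C}"
    and long: "k > (n - 1)\<^sup>2 + 1"
  shows "(fst B - fst A)\<^sup>2 = (fst C - fst A)\<^sup>2 \<and> (snd B - snd A)\<^sup>2 = (snd C - snd A)\<^sup>2"
proof -
  obtain a a' b b' c c' where pts:
      "A = (real a, real a')" "B = (real b, real b')" "C = (real c, real c')"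
    and bounds: "1 \<le> a" "a \<le> n" "1 \<le> b" "b \<le> n" "1 \<le> c" "c \<le> n"
    using grid unfolding mem_grid_iff by blast
  define x y u v where "x = int b - int a" and "y = int c - int a"
    and "u = int b' - int a'" and "v = int c' - int a'"
  have real_diffs: "fst B - fst A = of_int x" "fst C - fst A = of_int y"
      "snd B - snd A = of_int u" "snd C - snd A = of_int v"
    by (simp_all add: pts x_def y_def u_def v_def)
  have "real_of_int (x\<^sup>2 + u\<^sup>2) = real_of_int (y\<^sup>2 + v\<^sup>2)"
    using apex unfolding dist_eq_iff_sum_squares real_diffs by simp
  then have eq: "x\<^sup>2 + u\<^sup>2 = y\<^sup>2 + v\<^sup>2"
    by (simp only: of_int_eq_iff)
  have width: "z\<^sup>2 \<le> (int n - 1)\<^sup>2" if "\<bar>z\<bar> \<le> int n - 1" for z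
    using that by (simp add: abs_le_square_iff[symmetric])
  have x: "x\<^sup>2 \<le> (int n - 1)\<^sup>2" and y: "y\<^sup>2 \<le> (int n - 1)\<^sup>2"
    by (rule width; use bounds in \<open>simp add: x_def y_def\<close>)+
  have long': "(int n - 1)\<^sup>2 < int k - 1"
  proof -
    have "int ((n - 1)\<^sup>2 + 1) < int k" using long by (simp only: of_nat_less_iff)
    moreover have "int (n - 1) = int n - 1" using bounds by simp
    ultimately show ?thesis by simp
  qed
  have "1 \<in> {a', b', c'}" "k \<in> {a', b', c'}"
    using span by (auto simp: pts)
  then have legs: "int k - 1 \<le> \<bar>u\<bar> + \<bar>v\<bar>"
    unfolding u_def v_def by auto
  have "\<bar>u\<bar> = \<bar>v\<bar>"
  proof (rule ccontr)
    assume "\<bar>u\<bar> \<noteq> \<bar>v\<bar>"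
    then have "1 * (\<bar>u\<bar> + \<bar>v\<bar>) \<le> \<bar>\<bar>u\<bar> - \<bar>v\<bar>\<bar> * (\<bar>u\<bar> + \<bar>v\<bar>)"
      by (intro mult_right_mono) auto
    also have "\<dots> = \<bar>(\<bar>u\<bar> - \<bar>v\<bar>) * (\<bar>u\<bar> + \<bar>v\<bar>)\<bar>"
      by (simp add: abs_mult)
    also have "(\<bar>u\<bar> - \<bar>v\<bar>) * (\<bar>u\<bar> + \<bar>v\<bar>) = u\<^sup>2 - v\<^sup>2"
      using square_diff_square_factored[of "\<bar>u\<bar>" "\<bar>v\<bar>"]
      by (simp add: power2_eq_square mult.commute)
    also have "\<dots> = y\<^sup>2 - x\<^sup>2" using eq by simp
    also have "\<bar>\<dots>\<bar> \<le> (int n - 1)\<^sup>2"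
      using x y zero_le_power2[of x] zero_le_power2[of y] by linarith
    finally show False using order.strict_trans2[OF long' legs] by simp
  qed
  then have "u\<^sup>2 = v\<^sup>2" by (metis power2_abs)
  with eq have "x\<^sup>2 = y\<^sup>2" by simp
  with \<open>u\<^sup>2 = v\<^sup>2\<close> show ?thesis
    unfolding real_diffs by (metis of_int_power)
qed

text \<open>
  If the legs have the same vertical extent, then either the base is horizontal, or the apex is
  halfway between the rows of the other two vertices.
\<close>

lemma equal_extents_rows:
  fixes a b c l h :: real
  assumes "(b - a)\<^sup>2 = (c - a)\<^sup>2" and "l \<in> {a, b, c}" "h \<in> {a, b, c}"
    and "a \<in> {l..h}" "b \<in> {l..h}" "c \<in> {l..h}" and "y \<in> {a, b, c}"
  shows "y = l \<or> y = h \<or> 2 * y = l + h"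
proof -
  have "b = c \<or> b + c = 2 * a"
    using assms(1) unfolding power2_eq_iff by auto
  then show ?thesis using assms(2-) by auto
qed

text \<open>The affine map of the rows with \<open>1 \<mapsto> 1\<close> and \<open>k \<mapsto> k'\<close>.\<close>

abbreviation rescale :: "nat \<Rightarrow> nat \<Rightarrow> real \<times> real \<Rightarrow> real \<times> real" where
  "rescale k k' \<equiv> stretch_rows ((real k' - 1) / (real k - 1))
     (1 - (real k' - 1) / (real k - 1))"

text \<open>
  A vertex can lie in the middle row only if \<open>k\<close> is odd; then \<open>k'\<close> is odd as well, and the middle
  row goes to a middle row. This is where the recurrence gets its step of two from \<open>k\<close> to
  \<open>k - 2\<close>.
\<close>

lemma rescale_spanning_isosceles:
  assumes long: "k > (n - 1)\<^sup>2 + 1" "k' > (n - 1)\<^sup>2 + 1"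
    and parity: "even k \<longleftrightarrow> even k'"
    and T: "T \<in> spanning_isosceles n k"
  shows "rescale k k' ` T \<in> spanning_isosceles n k'"
proof -
  have sub: "T \<subseteq> grid n k" and iso: "isosceles_triangle T"
    and span: "1 \<in> snd ` T" "real k \<in> snd ` T"
    using T by (auto simp: spanning_isosceles_def)
  obtain A B C where ABC: "T = {A, B, C}" and apex: "dist A B = dist A C"
    using iso unfolding isosceles_triangle_def by blast
  have k: "real k - 1 > 0" "real k' - 1 > 0"
    using long by auto
  define c d where "c = (real k' - 1) / (real k - 1)" and "d = 1 - c"
  have c: "c \<noteq> 0" "c * (real k - 1) = real k' - 1"
    using k by (auto simp: c_def)
  have legs: "(fst B - fst A)\<^sup>2 = (fst C - fst A)\<^sup>2" "(snd B - snd A)\<^sup>2 = (snd C - snd A)\<^sup>2"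
    using long_legs_agree_coordinatewise[of A n k B C] sub apex span long(1)
    unfolding ABC by auto
  have first: "c * 1 + d = 1"
    by (simp add: d_def)
  have last: "c * real k + d = real k'"
    using c(2) by (simp add: d_def algebra_simps)
  have "isosceles_triangle (stretch_rows c d ` T)"
  proof -
    have diff: "snd (stretch_rows c d p) - snd (stretch_rows c d q) = c * (snd p - snd q)" for p q
      by (simp add: algebra_simps)
    have "dist (stretch_rows c d A) (stretch_rows c d B)
        = dist (stretch_rows c d A) (stretch_rows c d C)"
      unfolding dist_eq_iff_sum_squares diff power_mult_distrib fst_stretch_rows
      by (simp only: legs)
    then show ?thesis
      using isosceles_triangle_stretch_rowsI[OF c(1)] iso unfolding ABC by blast
  qed
  moreover have "stretch_rows c d ` T \<subseteq> grid n k'"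
  proof
    fix q assume "q \<in> stretch_rows c d ` T"
    then obtain p where p: "p \<in> T" "q = stretch_rows c d p" by blast
    have rows: "snd r \<in> {1..real k}" if "r \<in> T" for r
      using subsetD[OF sub that] by (auto simp: mem_grid_iff)
    obtain i j where ij: "p = (real i, real j)" "1 \<le> i" "i \<le> n"
      using subsetD[OF sub p(1)] unfolding mem_grid_iff by blast
    have "snd p = 1 \<or> snd p = real k \<or> 2 * snd p = 1 + real k"
      by (rule equal_extents_rows[OF legs(2)]) (use span rows p(1) in \<open>auto simp: ABC\<close>)
    then obtain j' where j': "1 \<le> j'" "j' \<le> k'" "c * snd p + d = real j'"
    proof (elim disjE)
      assume "snd p = 1"
      then show thesis using that[of 1] first k by simp
    next
      assume "snd p = real k"
      then show thesis using that[of k'] last k by simp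
    next
      assume mid: "2 * snd p = 1 + real k"
      \<comment> \<open>The vertex \<open>p\<close> is a grid point of the old grid, so its row \<open>j\<close> is an integer.\<close>
      then have "real (2 * j) = real (Suc k)"
        using ij(1) by simp
      then have "2 * j = Suc k" by (simp only: of_nat_eq_iff)
      then have "odd k" by presburger
      with parity have "odd k'" by simp
      then obtain m where m: "k' = 2 * m + 1" by (elim oddE)
      have "2 * (c * snd p + d) = (c * 1 + d) + (c * real k + d)"
        using arg_cong[OF mid, of "(*) c"] by (simp add: algebra_simps)
      then have "c * snd p + d = real (m + 1)"
        unfolding first last m by simp
      then show thesis using that[of "m + 1"] m by simp
    qed
    then show "q \<in> grid n k'"
      unfolding mem_grid_iff p(2) stretch_rows_def using ij by auto
  qed
  moreover have "1 \<in> snd ` stretch_rows c d ` T" "real k' \<in> snd ` stretch_rows c d ` T"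
  proof -
    obtain p q where "p \<in> T" "snd p = 1" "q \<in> T" "snd q = real k"
      using span by fastforce
    then show "1 \<in> snd ` stretch_rows c d ` T" "real k' \<in> snd ` stretch_rows c d ` T"
      using first last by (metis image_eqI snd_stretch_rows)+
  qed
  ultimately show ?thesis
    unfolding spanning_isosceles_def c_def d_def by blast
qed

lemma card_spanning_isosceles_le:
  assumes "k > (n - 1)\<^sup>2 + 1" "k' > (n - 1)\<^sup>2 + 1" "even k \<longleftrightarrow> even k'"
  shows "card (spanning_isosceles n k) \<le> card (spanning_isosceles n k')"
proof (rule card_inj_on_le[where f = "image (rescale k k')"])
  have "inj (rescale k k')"
    by (rule inj_stretch_rows) (use assms in auto)
  then show "inj_on (image (rescale k k')) (spanning_isosceles n k)"
    by (simp add: inj_on_def inj_image_eq_iff)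
qed (use rescale_spanning_isosceles[OF assms] finite_spanning_isosceles in auto)

lemma card_spanning_isosceles_parity:
  assumes "k > (n - 1)\<^sup>2 + 1" "k' > (n - 1)\<^sup>2 + 1" "even k \<longleftrightarrow> even k'"
  shows "card (spanning_isosceles n k) = card (spanning_isosceles n k')"
  using card_spanning_isosceles_le[of n k k'] card_spanning_isosceles_le[of n k' k] assms
  by (simp add: le_antisym)

section \<open>The recurrence\<close>

theorem theorem1:
  fixes n k :: nat
  assumes "n \<ge> 2" and "k > (n - 1)^2 + 3"
  shows "int (num_isosceles n k) =
           2 * int (num_isosceles n (k - 1)) - 2 * int (num_isosceles n (k - 3))
           + int (num_isosceles n (k - 4))"
proof -
  have "k = Suc (Suc (Suc (Suc (k - 4))))"
    using assms(2) by simp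
  then obtain m where k: "k = Suc (Suc (Suc (Suc m)))"
    by blast
  have "card (spanning_isosceles n k) = card (spanning_isosceles n (Suc (Suc m)))"
    by (rule card_spanning_isosceles_parity) (use assms(2) k in auto)
  then show ?thesis
    using second_difference_num_isosceles[of n "Suc (Suc m)"]
      second_difference_num_isosceles[of n m]
    by (simp add: k)
qed

end
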